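(* Let $I\subseteq\mathbb{R}$ be an open interval and, for integers $i,j,k\ge 0$, let $\mu_{i,j}^k(t)=-\mu_{j,i}^k(t)$ and $\beta_i^k(t)$ be real-valued smooth functions of $t\in I$. Set $Pf(i,j)^k=\mu_{i,j}^k$, $Pf(d_0,i)^k=\beta_i^k$, $Pf(d_1,i)^k=\beta_{i+1}^k$, $Pf(d_0,d_1)^k=0$, and assume $$\frac{d}{dt}Pf(i,j)^k=Pf(i+1,j)^k+Pf(i,j+1)^k,\qquad \frac{d}{dt}Pf(d_0,i)^k=Pf(d_0,i+1)^k,$$ $$Pf(i,j)^{k+1}=Pf(i,j)^k+Pf(d_0,d_1,i,j)^k,\qquad Pf(d_0,i)^{k+1}=Pf(d_0,i)^k+Pf(d_1,i)^k.$$ Define $$\tau_{2n}^k(t)=Pf(0,1,\dots,2n-1)^k,\qquad \tau_{2n+1}^k(t)=Pf(d_0,0,1,\dots,2n)^k,$$ and assume $\tau_n^k\neq 0$ on $I$ for all $n,k\ge 0$. Then $$r_n^k=\frac{\tau_n^{k+1}}{\tau_n^k},\qquad v_n^k=\frac{\tau_{n+1}^k}{\tau_n^{k+1}}$$ satisfy the Toda lattice of BKP type in $1+2$ dimension: $$\frac{d}{dt}r_n^k=\frac{v_n^kr_n^k}{v_{n-1}^kr_{n-1}^k}\,(r_{n-1}^k-r_{n+1}^k)\quad(n\ge 1,\ k\ge 0),\qquad v_n^kr_n^k=r_{n+1}^{k-1}v_n^{k-1}\quad(n\ge 0,\ k\ge 1).$$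
   Context: Hirota's Pfaffian notation: given symbols $a_1,\dots,a_{2N}$ and prescribed entries $Pf(a_i,a_j)=-Pf(a_j,a_i)$, $Pf(a_1,\dots,a_{2N})$ denotes the Pfaffian of the $2N\times 2N$ skew-symmetric matrix with $(i,j)$ entry $Pf(a_i,a_j)$; the empty Pfaffian is $1$ (so $\tau_0^k=1$). A superscript $k$ on $Pf$ means the entries with that superscript are used. In particular $Pf(d_0,d_1,i,j)^k=\beta_{i+1}^k\beta_j^k-\beta_i^k\beta_{j+1}^k$. *)

theory Defs
  imports "HOL-Analysis.Analysis" "HOL-Combinatorics.Permutations"
begin

text \<open>
  The Pfaffian of the skew-symmetric \<open>2N \<times> 2N\<close> matrix \<open>A\<close>, rows and columns numbered from 0:
  each perfect matching of the \<open>2N\<close> indices is represented by exactly \<open>2 ^ N * fact N\<close>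
  permutations, all contributing the same signed product.
\<close>

definition pfaffian :: "nat \<Rightarrow> (nat \<Rightarrow> nat \<Rightarrow> 'a::field_char_0) \<Rightarrow> 'a" where
  "pfaffian N A = (\<Sum>p | p permutes {..<2 * N}.
      of_int (sign p) * (\<Prod>i<N. A (p (2 * i)) (p (2 * i + 1)))) / (2 ^ N * fact N)"

text \<open>
  Hirota's notation \<open>Pf(a\<^sub>1, \<dots>, a\<^sub>2\<^sub>N)\<close> for a list of symbols of even length and
  prescribed entries \<open>e a b = Pf(a, b)\<close>.
\<close>

definition hirota_pf :: "('s \<Rightarrow> 's \<Rightarrow> 'a::field_char_0) \<Rightarrow> 's list \<Rightarrow> 'a" where
  "hirota_pf e as = pfaffian (length as div 2) (\<lambda>i j. e (as ! i) (as ! j))"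

datatype symb = D0 | D1 | Ix nat

text \<open>
  The entries at level \<open>k\<close> and time \<open>t\<close>, where \<open>\<mu> i j k t\<close> stands for
  \<open>\<mu>\<^sub>i\<^sub>,\<^sub>j\<^sup>k(t)\<close> and \<open>\<beta> i k t\<close> for \<open>\<beta>\<^sub>i\<^sup>k(t)\<close>.
\<close>

fun pf_entry :: "(nat \<Rightarrow> nat \<Rightarrow> nat \<Rightarrow> real \<Rightarrow> real) \<Rightarrow> (nat \<Rightarrow> nat \<Rightarrow> real \<Rightarrow> real) \<Rightarrow>
    nat \<Rightarrow> real \<Rightarrow> symb \<Rightarrow> symb \<Rightarrow> real" where
  "pf_entry \<mu> \<beta> k t (Ix i) (Ix j) = \<mu> i j k t"
| "pf_entry \<mu> \<beta> k t D0 (Ix i) = \<beta> i k t"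
| "pf_entry \<mu> \<beta> k t (Ix i) D0 = - \<beta> i k t"
| "pf_entry \<mu> \<beta> k t D1 (Ix i) = \<beta> (i + 1) k t"
| "pf_entry \<mu> \<beta> k t (Ix i) D1 = - \<beta> (i + 1) k t"
| "pf_entry \<mu> \<beta> k t D0 D0 = 0"
| "pf_entry \<mu> \<beta> k t D0 D1 = 0"
| "pf_entry \<mu> \<beta> k t D1 D0 = 0"
| "pf_entry \<mu> \<beta> k t D1 D1 = 0"

definition bkp_pf :: "(nat \<Rightarrow> nat \<Rightarrow> nat \<Rightarrow> real \<Rightarrow> real) \<Rightarrow> (nat \<Rightarrow> nat \<Rightarrow> real \<Rightarrow> real) \<Rightarrow>
    nat \<Rightarrow> real \<Rightarrow> symb list \<Rightarrow> real" where
  "bkp_pf \<mu> \<beta> k t as = hirota_pf (pf_entry \<mu> \<beta> k t) as"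

text \<open>\<open>\<tau>\<^sub>2\<^sub>n = Pf(0, \<dots>, 2n - 1)\<close> and \<open>\<tau>\<^sub>2\<^sub>n\<^sub>+\<^sub>1 = Pf(d\<^sub>0, 0, \<dots>, 2n)\<close>, indexed by the subscript of \<open>\<tau>\<close>.\<close>

definition bkp_tau :: "(nat \<Rightarrow> nat \<Rightarrow> nat \<Rightarrow> real \<Rightarrow> real) \<Rightarrow> (nat \<Rightarrow> nat \<Rightarrow> real \<Rightarrow> real) \<Rightarrow>
    nat \<Rightarrow> nat \<Rightarrow> real \<Rightarrow> real" where
  "bkp_tau \<mu> \<beta> n k t =
    (if even n then bkp_pf \<mu> \<beta> k t (map Ix [0..<n])
     else bkp_pf \<mu> \<beta> k t (D0 # map Ix [0..<n]))"

definition bkp_r :: "(nat \<Rightarrow> nat \<Rightarrow> nat \<Rightarrow> real \<Rightarrow> real) \<Rightarrow> (nat \<Rightarrow> nat \<Rightarrow> real \<Rightarrow> real) \<Rightarrow>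
    nat \<Rightarrow> nat \<Rightarrow> real \<Rightarrow> real" where
  "bkp_r \<mu> \<beta> n k t = bkp_tau \<mu> \<beta> n (k + 1) t / bkp_tau \<mu> \<beta> n k t"

definition bkp_v :: "(nat \<Rightarrow> nat \<Rightarrow> nat \<Rightarrow> real \<Rightarrow> real) \<Rightarrow> (nat \<Rightarrow> nat \<Rightarrow> real \<Rightarrow> real) \<Rightarrow>
    nat \<Rightarrow> nat \<Rightarrow> real \<Rightarrow> real" where
  "bkp_v \<mu> \<beta> n k t = bkp_tau \<mu> \<beta> (n + 1) k t / bkp_tau \<mu> \<beta> n (k + 1) t"

text \<open>Infinitely differentiable on the set \<open>I\<close>; meant for open \<open>I\<close>, since \<^const>\<open>deriv\<close> is two-sided.\<close>

definition smooth_real_on :: "real set \<Rightarrow> (real \<Rightarrow> real) \<Rightarrow> bool" where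
  "smooth_real_on I f \<longleftrightarrow> (\<forall>m. \<forall>t\<in>I. (deriv ^^ m) f differentiable (at t))"

end

theory Submission
  imports Defs
begin

text \<open>
  Dividing out the denominators, the first equation is the bilinear relation
  \<open>\<tau>\<^sub>n \<cdot> d/dt \<tau>\<^sub>n\<^sup>k\<^sup>+\<^sup>1 - \<tau>\<^sub>n\<^sup>k\<^sup>+\<^sup>1 \<cdot> d/dt \<tau>\<^sub>n
    = \<tau>\<^sub>n\<^sub>+\<^sub>1 \<cdot> \<tau>\<^sub>n\<^sub>-\<^sub>1\<^sup>k\<^sup>+\<^sup>1 - \<tau>\<^sub>n\<^sub>+\<^sub>1\<^sup>k\<^sup>+\<^sup>1 \<cdot> \<tau>\<^sub>n\<^sub>-\<^sub>1\<close>
  (unmarked quantities at level \<open>k\<close>), while the second is an identity between the quotients.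
  The derivative of \<open>\<tau>\<^sub>n\<close> shifts one index at a time, and only the shift of the last index
  avoids a repeated symbol. Passing to level \<open>k + 1\<close> is a rank-two update of the entries, which
  adds \<open>Pf(d\<^sub>0, d\<^sub>1, \<dots>)\<close> to the even Pfaffians and replaces \<open>d\<^sub>0\<close> by \<open>d\<^sub>0 + d\<^sub>1\<close> in the
  odd ones. After both substitutions the bilinear relation is a four-term Pluecker relation
  for Pfaffians in the symbols \<open>d\<^sub>0, d\<^sub>1, n - 1, n\<close>. The Pluecker relations come from expanding
  one factor of \<open>\<Sum>\<^sub>a \<plusminus> Pf(A - a) Pf(a, B)\<close> along \<open>a\<close> and exchanging the two sums.
\<close>

section \<open>Signed sums over the elements of a list\<close>

text \<open>
  \<open>signed_sum H G [a\<^sub>0, a\<^sub>1, \<dots>]\<close> is \<open>\<Sum>\<^sub>j (-1)\<^sup>j H(a\<^sub>j) G(the list without a\<^sub>j)\<close>, the contraction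
  of \<open>G\<close> by the covector \<open>H\<close>; with \<open>H = Pf(a, \<cdot>)\<close> it is the expansion of a Pfaffian along \<open>a\<close>.
\<close>

primrec signed_sum :: "('s \<Rightarrow> 'a::comm_ring_1) \<Rightarrow> ('s list \<Rightarrow> 'a) \<Rightarrow> 's list \<Rightarrow> 'a" where
  "signed_sum H G [] = 0"
| "signed_sum H G (a # as) = H a * G as - signed_sum H (\<lambda>l. G (a # l)) as"

lemma signed_sum_cong:
  assumes "\<And>a. a \<in> set as \<Longrightarrow> H a = H' a"
    and "\<And>l. length l < length as \<Longrightarrow> set l \<subseteq> set as \<Longrightarrow> G l = G' l"
  shows "signed_sum H G as = signed_sum H' G' as"
  using assms
proof (induction as arbitrary: G G')
  case (Cons a as)
  have "G (a # l) = G' (a # l)" if "length l < length as" "set l \<subseteq> set as" for l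
    using that by (intro Cons.prems(2)) auto
  then have "signed_sum H (\<lambda>l. G (a # l)) as = signed_sum H' (\<lambda>l. G' (a # l)) as"
    using Cons.prems(1) by (intro Cons.IH) auto
  moreover have "G as = G' as"
    using Cons.prems by auto
  ultimately show ?case
    using Cons.prems(1)[of a] by simp
qed simp

text \<open>Serves the termination proof of \<open>pf_list\<close>, which passes itself unapplied to
  \<open>signed_sum\<close>: the recursion only ever reaches strictly shorter lists.\<close>

lemma signed_sum_fundef_cong [fundef_cong]:
  assumes "as = as'" and "\<And>a. H a = H' a"
    and "\<And>l. length l < length as' \<Longrightarrow> G l = G' l"
  shows "signed_sum H G as = signed_sum H' G' as'"
  using assms by (auto intro: signed_sum_cong)

lemma signed_sum_add_left:
  "signed_sum (\<lambda>a. H a + K a) G as = signed_sum H G as + signed_sum K G as"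
  by (induction as arbitrary: G) (simp_all add: algebra_simps)

lemma signed_sum_mult_left: "signed_sum (\<lambda>a. c * H a) G as = c * signed_sum H G as"
  by (induction as arbitrary: G) (simp_all add: algebra_simps)

lemma signed_sum_uminus_left: "signed_sum (\<lambda>a. - H a) G as = - signed_sum H G as"
  using signed_sum_mult_left[of "- 1" H] by simp

lemma signed_sum_diff_left:
  "signed_sum (\<lambda>a. H a - K a) G as = signed_sum H G as - signed_sum K G as"
  by (induction as arbitrary: G) (simp_all add: algebra_simps)

lemma signed_sum_zero_left: "signed_sum (\<lambda>a. 0) G as = 0"
  by (induction as arbitrary: G) simp_all

lemma signed_sum_add_right:
  "signed_sum H (\<lambda>l. F l + G l) as = signed_sum H F as + signed_sum H G as"
  by (induction as arbitrary: F G) (simp_all add: algebra_simps)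

lemma signed_sum_mult_right: "signed_sum H (\<lambda>l. c * G l) as = c * signed_sum H G as"
  by (induction as arbitrary: G) (simp_all add: algebra_simps)

lemma signed_sum_uminus_right: "signed_sum H (\<lambda>l. - G l) as = - signed_sum H G as"
  using signed_sum_mult_right[of H "- 1" G] by simp

lemma signed_sum_diff_right:
  "signed_sum H (\<lambda>l. F l - G l) as = signed_sum H F as - signed_sum H G as"
  by (induction as arbitrary: F G) (simp_all add: algebra_simps)

lemma signed_sum_conv_sum:
  "signed_sum H G as =
    (\<Sum>j<length as. (- 1) ^ j * H (as ! j) * G (take j as @ drop (Suc j) as))"
  by (induction as arbitrary: G)
    (simp_all del: sum.lessThan_Suc add: sum.lessThan_Suc_shift sum_negf)

text \<open>Removing one element lowers the position of another by one exactly when it precedes it,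
  so reversing the order of two removals flips the sign.\<close>

lemma signed_sum_anticommute:
  "signed_sum H (signed_sum K G) as = - signed_sum K (signed_sum H G) as"
  by (induction as arbitrary: G)
    (simp_all add: signed_sum_diff_right signed_sum_mult_right)

lemma eq_uminus_self_iff:
  fixes x :: "'a::{idom, ring_char_0}"
  shows "x = - x \<longleftrightarrow> x = 0"
proof
  assume "x = - x"
  then have "2 * x = 0"
    unfolding mult_2 by (simp only: eq_neg_iff_add_eq_0)
  then show "x = 0"
    by simp
qed simp

lemma signed_sum_square:
  fixes H :: "'s \<Rightarrow> 'a::{idom, ring_char_0}"
  shows "signed_sum H (signed_sum H G) as = 0"
  using signed_sum_anticommute[of H H G as] by (simp only: eq_uminus_self_iff)

lemma signed_sum_sandwich:
  fixes H :: "'s \<Rightarrow> 'a::{idom, ring_char_0}"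
  shows "signed_sum H (signed_sum K (signed_sum H G)) as = 0"
proof -
  have "signed_sum K (signed_sum H G) = (\<lambda>l. - signed_sum H (signed_sum K G) l)"
    by (rule ext) (rule signed_sum_anticommute)
  then show ?thesis
    by (simp add: signed_sum_uminus_right signed_sum_square)
qed

text \<open>Both sides are the same double sum of \<open>e a b\<close> times the two signed
  complements, taken in either order.\<close>

lemma signed_sum_exchange:
  "signed_sum (\<lambda>a. signed_sum (e a) G bs) K as =
    signed_sum (\<lambda>b. signed_sum (\<lambda>a. e a b) K as) G bs"
  by (induction as arbitrary: K)
    (simp_all add: signed_sum_zero_left signed_sum_diff_left signed_sum_mult_left mult.commute)

section \<open>Alternating functions and Pfaffians of lists\<close>

definition alternating :: "('s list \<Rightarrow> 'a::comm_ring_1) \<Rightarrow> bool" where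
  "alternating G \<longleftrightarrow> (\<forall>xs a b ys. G (xs @ a # b # ys) = - G (xs @ b # a # ys))"

lemma alternatingD: "alternating G \<Longrightarrow> G (xs @ a # b # ys) = - G (xs @ b # a # ys)"
  unfolding alternating_def by blast

lemma alternating_Cons:
  assumes "alternating G"
  shows "alternating (\<lambda>l. G (a # l))"
  unfolding alternating_def
proof (intro allI)
  fix xs b c ys
  show "G (a # xs @ b # c # ys) = - G (a # xs @ c # b # ys)"
    using alternatingD[OF assms, of "a # xs" b c ys] by (simp only: append_Cons)
qed

lemma alternating_move:
  assumes "alternating G"
  shows "G (xs @ a # ys @ zs) = (- 1) ^ length ys * G (xs @ ys @ a # zs)"
proof (induction ys arbitrary: xs)
  case (Cons y ys)
  show ?case
    using alternatingD[OF assms, of xs a y "ys @ zs"] Cons.IH[of "xs @ [y]"] by simp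
qed simp

lemma alternating_move_back:
  assumes "alternating G"
  shows "G (xs @ ys @ a # zs) = (- 1) ^ length ys * G (xs @ a # ys @ zs)"
  unfolding alternating_move[OF assms] by (simp add: mult.assoc[symmetric])

lemma alternating_swap:
  assumes "alternating G"
  shows "G (xs @ a # ys @ b # zs) = - G (xs @ b # ys @ a # zs)"
proof -
  have "G (xs @ a # ys @ b # zs) = (- 1) ^ length ys * G (xs @ ys @ a # b # zs)"
    by (rule alternating_move[OF assms])
  also have "G (xs @ ys @ a # b # zs) = - G (xs @ ys @ b # a # zs)"
    using alternatingD[OF assms, of "xs @ ys" a b zs] by simp
  also have "(- 1) ^ length ys * (- G (xs @ ys @ b # a # zs)) = - G (xs @ b # ys @ a # zs)"
    using alternating_move[OF assms, of xs b ys "a # zs"] by simp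
  finally show ?thesis .
qed

lemma alternating_repeat:
  fixes G :: "'s list \<Rightarrow> 'a::{idom, ring_char_0}"
  assumes "alternating G" and "a \<in> set bs"
  shows "G (a # bs) = 0"
proof -
  obtain ys zs where "bs = ys @ a # zs"
    using assms(2) by (meson split_list)
  then show ?thesis
    using alternating_swap[OF assms(1), of "[]" a ys a zs]
    by (simp only: append_Nil eq_uminus_self_iff)
qed

lemma alternating_map_transpose:
  assumes "alternating G" and "i < j" and "j < n"
  shows "G (map (s \<circ> Transposition.transpose i j) [0..<n]) = - G (map s [0..<n])"
proof -
  have "[0..<n] = [0..<i] @ [i..<n]"
    using assms upt_add_eq_append[of 0 i "n - i"] by simp
  also have "[i..<n] = i # [Suc i..<n]"
    using assms by (simp add: upt_conv_Cons)
  also have "[Suc i..<n] = [Suc i..<j] @ [j..<n]"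
    using assms upt_add_eq_append[of "Suc i" j "n - j"] by simp
  also have "[j..<n] = j # [Suc j..<n]"
    using assms by (simp add: upt_conv_Cons)
  finally have split: "[0..<n] = [0..<i] @ i # [Suc i..<j] @ j # [Suc j..<n]" .
  have "map (s \<circ> Transposition.transpose i j) [0..<n] =
      map s [0..<i] @ s j # map s [Suc i..<j] @ s i # map s [Suc j..<n]"
    unfolding split using \<open>i < j\<close> by (auto simp: Transposition.transpose_def)
  also have "G \<dots> = - G (map s [0..<i] @ s i # map s [Suc i..<j] @ s j # map s [Suc j..<n])"
    by (rule alternating_swap[OF assms(1)])
  finally show ?thesis
    by (subst (2) split) simp
qed

text \<open>The Pfaffian made total on lists: odd length gives the value 0, so the identities below
  make sense for either parity.\<close>

fun pf_list :: "('s \<Rightarrow> 's \<Rightarrow> 'a::comm_ring_1) \<Rightarrow> 's list \<Rightarrow> 'a" where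
  "pf_list e [] = 1"
| "pf_list e (a # as) = signed_sum (e a) (pf_list e) as"

lemma alternating_signed_sum:
  assumes "alternating G"
  shows "alternating (signed_sum H G)"
proof -
  have "signed_sum H G (xs @ a # b # ys) = - signed_sum H G (xs @ b # a # ys)" for xs a b ys
    using assms
  proof (induction xs arbitrary: G)
    case Nil
    have "(\<lambda>l. G (a # b # l)) = (\<lambda>l. - G (b # a # l))"
      by (intro ext) (metis alternatingD[OF Nil] append_Nil)
    then show ?case
      by (simp add: signed_sum_uminus_right)
  next
    case (Cons x xs)
    show ?case
      using Cons.IH[OF alternating_Cons[OF Cons.prems, of x]] alternatingD[OF Cons.prems, of xs a b ys]
      by simp
  qed
  then show ?thesis
    unfolding alternating_def by blast
qed

text \<open>Exchanging the two leading symbols reduces to skewness of \<open>e\<close> and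
  anticommutation of their contractions; a swap further inside is inherited through the
  expansion.\<close>

lemma alternating_pf_list:
  assumes skew: "\<And>a b. e a b = - e b a"
  shows "alternating (pf_list e)"
proof -
  \<comment> \<open>Truncating by length lets the induction use that contraction preserves alternation.\<close>
  have trunc: "alternating (\<lambda>l. if length l < n then pf_list e l else 0)" for n
  proof (induction n)
    case 0
    then show ?case by (simp add: alternating_def)
  next
    case (Suc n)
    let ?G = "\<lambda>l. if length l < n then pf_list e l else 0"
    have swap: "pf_list e (xs @ a # b # ys) = - pf_list e (xs @ b # a # ys)"
      if "length (xs @ a # b # ys) \<le> n" for xs a b ys
    proof (cases xs)
      case Nil
      then show ?thesis
        using skew[of a b] signed_sum_anticommute[of "e a" "e b" "pf_list e" ys] by simp
    next
      case (Cons x us)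
      have "pf_list e (xs @ c # d # ys) = signed_sum (e x) ?G (us @ c # d # ys)"
        if "length (xs @ c # d # ys) \<le> n" for c d
        using that Cons by (auto intro!: signed_sum_cong)
      then show ?thesis
        using that alternatingD[OF alternating_signed_sum[OF Suc.IH], of "e x" us a b ys] by auto
    qed
    show ?case
      unfolding alternating_def
    proof (intro allI)
      fix xs a b ys
      show "(if length (xs @ a # b # ys) < Suc n then pf_list e (xs @ a # b # ys) else 0) =
          - (if length (xs @ b # a # ys) < Suc n then pf_list e (xs @ b # a # ys) else 0)"
        using swap[of xs a b ys] by (auto simp: less_Suc_eq_le)
    qed
  qed
  have "pf_list e (xs @ a # b # ys) = - pf_list e (xs @ b # a # ys)" for xs a b ys
    using alternatingD[OF trunc[of "Suc (length (xs @ a # b # ys))"], of xs a b ys] by simp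
  then show ?thesis
    unfolding alternating_def by blast
qed

section \<open>The recursive Pfaffian as a sum over permutations\<close>

lemma alternating_sign_transpose:
  assumes "alternating G" and "i < n" and "j < n"
  shows "G (map (s \<circ> Transposition.transpose i j) [0..<n]) =
    of_int (sign (Transposition.transpose i j)) * G (map s [0..<n])"
proof -
  consider "i = j" | "i < j" | "j < i" by linarith
  then show ?thesis
  proof cases
    case 1
    then show ?thesis by (simp add: sign_id)
  next
    case 2
    then show ?thesis
      by (simp add: sign_swap_id alternating_map_transpose[OF assms(1) 2 assms(3)])
  next
    case 3
    then show ?thesis
      by (subst (1 2) transpose_commute)
        (simp add: sign_swap_id alternating_map_transpose[OF assms(1) 3 assms(2)])
  qed
qed

text \<open>
  Removes the element at position \<open>c\<close> by exchanging it with the last one, the form in which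
  \<open>sum_over_permutations_insert\<close> splits a permutation.
\<close>

lemma signed_sum_map_transpose:
  assumes "alternating G"
  shows "signed_sum H G (map s [0..<Suc m]) =
    (- 1) ^ m * (\<Sum>c<Suc m. of_int (sign (Transposition.transpose m c)) * H (s c) *
      G (map (s \<circ> Transposition.transpose m c) [0..<m]))"
proof -
  let ?L = "map s [0..<Suc m]"
  have "(- 1) ^ c * H (?L ! c) * G (take c ?L @ drop (Suc c) ?L) =
      (- 1) ^ m * (of_int (sign (Transposition.transpose m c)) * H (s c) *
        G (map (s \<circ> Transposition.transpose m c) [0..<m]))" if "c < Suc m" for c
  proof (cases "c = m")
    case True
    then show ?thesis
      by (simp add: take_map drop_map nth_append sign_swap_id)
  next
    case False
    with that have "c < m" by simp
    \<comment> \<open>\<open>d\<close> counts the entries strictly between positions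
      \<open>c\<close> and \<open>m\<close>. The last entry crosses them on its way into the gap,
      and the transposition contributes one more sign.\<close>
    then obtain d where d: "m = c + Suc d"
      using less_imp_Suc_add by auto
    have split: "[0..<m] = [0..<c] @ c # [Suc c..<m]"
      using upt_add_eq_append[of 0 c "m - c"] \<open>c < m\<close> by (simp add: upt_conv_Cons)
    have "map (s \<circ> Transposition.transpose m c) [0..<m] =
        map s [0..<c] @ s m # map s [Suc c..<m]"
      unfolding split using \<open>c < m\<close> by (auto simp: Transposition.transpose_def)
    moreover have "take c ?L @ drop (Suc c) ?L = map s [0..<c] @ map s [Suc c..<m] @ [s m]"
      using \<open>c < m\<close> by (simp add: take_map drop_map)
    moreover have "G (map s [0..<c] @ s m # map s [Suc c..<m]) =
        (- 1) ^ d * G (map s [0..<c] @ map s [Suc c..<m] @ [s m])"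
      using alternating_move[OF assms, of "map s [0..<c]" "s m" "map s [Suc c..<m]" "[]"]
      by (simp add: d del: upt_Suc)
    moreover have "?L ! c = s c"
      using \<open>c < m\<close> by (simp add: nth_append)
    moreover have "(- 1 :: 'b) ^ c = - ((- 1) ^ m * (- 1) ^ d)"
      unfolding d power_add by (simp add: mult.assoc)
    ultimately show ?thesis
      using False by (simp add: sign_swap_id mult_ac del: upt_Suc)
  qed
  then show ?thesis
    unfolding signed_sum_conv_sum sum_distrib_left by (auto intro!: sum.cong)
qed

text \<open>Bringing the last symbol to the front passes \<open>2 * N + 1\<close> others; the
  resulting minus sign is absorbed by skewness of the entries.\<close>

lemma pf_list_expand_last:
  assumes skew: "\<And>a b. e a b = - e b a"
  shows "pf_list e (map s [0..<Suc (Suc (2 * N))]) =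
    (\<Sum>c<Suc (2 * N). of_int (sign (Transposition.transpose (2 * N) c)) *
      e (s c) (s (Suc (2 * N))) * pf_list e (map (s \<circ> Transposition.transpose (2 * N) c) [0..<2 * N]))"
proof -
  let ?L = "map s [0..<Suc (2 * N)]" and ?x = "s (Suc (2 * N))"
  have "pf_list e (?x # ?L) = - pf_list e (?L @ [?x])"
    using alternating_move[OF alternating_pf_list[of e, OF skew], of "[]" ?x ?L "[]"]
    by (simp del: upt_Suc pf_list.simps)
  then have "pf_list e (map s [0..<Suc (Suc (2 * N))]) = - signed_sum (e ?x) (pf_list e) ?L"
    by simp
  also have "\<dots> = (\<Sum>c<Suc (2 * N). - (of_int (sign (Transposition.transpose (2 * N) c)) *
      e ?x (s c) * pf_list e (map (s \<circ> Transposition.transpose (2 * N) c) [0..<2 * N])))"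
    unfolding signed_sum_map_transpose[OF alternating_pf_list[of e, OF skew]]
    by (simp del: sum.lessThan_Suc add: sum_negf)
  also have "\<dots> = (\<Sum>c<Suc (2 * N). of_int (sign (Transposition.transpose (2 * N) c)) *
      e (s c) ?x * pf_list e (map (s \<circ> Transposition.transpose (2 * N) c) [0..<2 * N]))"
    by (intro sum.cong refl) (subst skew, simp)
  finally show ?thesis .
qed

lemma sum_permutes_lessThan_Suc:
  "(\<Sum>p | p permutes {..<Suc n}. f p) =
    (\<Sum>b<Suc n. \<Sum>q | q permutes {..<n}. f (Transposition.transpose n b \<circ> q))"
  unfolding lessThan_Suc by (rule sum_over_permutations_insert) auto

text \<open>Induction on \<open>N\<close> with arbitrary \<open>s\<close>. Splitting off two
  transpositions leaves, for each \<open>b\<close>, the expansion along the last symbol of a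
  transposed list. Alternation cancels the sign of that transposition, so all
  \<open>2 * N + 2\<close> values of \<open>b\<close> contribute equally, which accounts for the
  growth of \<open>2 ^ N * fact N\<close>.\<close>

lemma sum_permutes_eq_pf_list:
  fixes e :: "'s \<Rightarrow> 's \<Rightarrow> 'a::{comm_ring_1, ring_char_0}"
  assumes skew: "\<And>a b. e a b = - e b a"
  shows "(\<Sum>p | p permutes {..<2 * N}.
      of_int (sign p) * (\<Prod>i<N. e (s (p (2 * i))) (s (p (2 * i + 1))))) =
    2 ^ N * fact N * pf_list e (map s [0..<2 * N])"
proof (induction N arbitrary: s)
  case 0
  show ?case by simp
next
  case (Suc N)
  let ?w = "\<lambda>M s p. of_int (sign p) * (\<Prod>i<M. e (s (p (2 * i))) (s (p (2 * i + 1))))"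
  let ?m = "2 * N" and ?n = "Suc (2 * N)"
  let ?\<tau> = "Transposition.transpose :: nat \<Rightarrow> nat \<Rightarrow> nat \<Rightarrow> nat"
  let ?\<epsilon> = "\<lambda>i j. of_int (sign (?\<tau> i j)) :: 'a"
  have two_Suc: "2 * Suc N = Suc ?n"
    by simp
  \<comment> \<open>\<open>q\<close> fixes the two largest indices, so the last factor of the
    product depends on \<open>b\<close> and \<open>c\<close> alone, and the rest is the summand for
    \<open>N\<close> with relabelled symbols.\<close>
  have w: "?w (Suc N) s (?\<tau> ?n b \<circ> (?\<tau> ?m c \<circ> q)) =
      ?\<epsilon> ?n b * (?\<epsilon> ?m c * e ((s \<circ> ?\<tau> ?n b) c) ((s \<circ> ?\<tau> ?n b) ?n) * ?w N (s \<circ> ?\<tau> ?n b \<circ> ?\<tau> ?m c) q)"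
    if q: "q permutes {..<?m}" and c: "c < ?n" for b c q
  proof -
    have "permutation q"
      using q by (auto intro: permutes_imp_permutation)
    then have "sign (?\<tau> ?n b \<circ> (?\<tau> ?m c \<circ> q)) = sign (?\<tau> ?n b) * (sign (?\<tau> ?m c) * sign q)"
      by (simp add: sign_compose permutation_compose permutation_swap_id)
    moreover have "q ?m = ?m" "q ?n = ?n"
      using q by (auto simp: permutes_def)
    moreover have "?\<tau> ?m c ?n = ?n"
      using c by (auto simp: Transposition.transpose_def)
    ultimately show ?thesis
      by (simp add: mult_ac)
  qed
  have "(\<Sum>p | p permutes {..<2 * Suc N}. ?w (Suc N) s p) =
      (\<Sum>b<Suc ?n. \<Sum>c<?n. \<Sum>q | q permutes {..<?m}. ?w (Suc N) s (?\<tau> ?n b \<circ> (?\<tau> ?m c \<circ> q)))"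
    unfolding two_Suc sum_permutes_lessThan_Suc ..
  also have "\<dots> = (\<Sum>b<Suc ?n. \<Sum>c<?n. \<Sum>q | q permutes {..<?m}.
      ?\<epsilon> ?n b * (?\<epsilon> ?m c * e ((s \<circ> ?\<tau> ?n b) c) ((s \<circ> ?\<tau> ?n b) ?n) * ?w N (s \<circ> ?\<tau> ?n b \<circ> ?\<tau> ?m c) q))"
    by (intro sum.cong refl w) auto
  also have "\<dots> = (\<Sum>b<Suc ?n. ?\<epsilon> ?n b * (\<Sum>c<?n. ?\<epsilon> ?m c * e ((s \<circ> ?\<tau> ?n b) c) ((s \<circ> ?\<tau> ?n b) ?n) *
      (2 ^ N * fact N * pf_list e (map (s \<circ> ?\<tau> ?n b \<circ> ?\<tau> ?m c) [0..<?m]))))"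
    unfolding sum_distrib_left[symmetric] Suc.IH ..
  also have "\<dots> = (\<Sum>b<Suc ?n. ?\<epsilon> ?n b * (2 ^ N * fact N *
      pf_list e (map (s \<circ> ?\<tau> ?n b) [0..<Suc ?n])))"
    unfolding pf_list_expand_last[of e, OF skew] sum_distrib_left
    by (intro sum.cong refl) (simp only: mult_ac)
  also have "\<dots> = (\<Sum>b<Suc ?n. 2 ^ N * fact N * pf_list e (map s [0..<Suc ?n]))"
  proof (intro sum.cong refl)
    fix b assume "b \<in> {..<Suc ?n}"
    then have "pf_list e (map (s \<circ> ?\<tau> ?n b) [0..<Suc ?n]) = ?\<epsilon> ?n b * pf_list e (map s [0..<Suc ?n])"
      by (intro alternating_sign_transpose alternating_pf_list skew) auto
    moreover have "?\<epsilon> ?n b * ?\<epsilon> ?n b = 1"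
      by (simp flip: of_int_mult)
    ultimately show "?\<epsilon> ?n b * (2 ^ N * fact N * pf_list e (map (s \<circ> ?\<tau> ?n b) [0..<Suc ?n])) =
        2 ^ N * fact N * pf_list e (map s [0..<Suc ?n])"
      by (simp add: mult_ac del: upt_Suc) (simp add: mult.assoc[symmetric] del: upt_Suc)
  qed
  also have "\<dots> = 2 ^ Suc N * fact (Suc N) * pf_list e (map s [0..<2 * Suc N])"
    by (simp add: algebra_simps del: upt_Suc)
  finally show ?case .
qed

lemma hirota_pf_eq_pf_list:
  fixes e :: "'s \<Rightarrow> 's \<Rightarrow> 'a::field_char_0"
  assumes "\<And>a b. e a b = - e b a" and "even (length as)"
  shows "hirota_pf e as = pf_list e as"
proof -
  have "2 * (length as div 2) = length as"
    using assms(2) by simp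
  then show ?thesis
    unfolding hirota_pf_def pfaffian_def
    using sum_permutes_eq_pf_list[of e "(!) as" "length as div 2", OF assms(1)]
    by (simp add: map_nth)
qed

section \<open>Pluecker relations and rank-two updates\<close>

text \<open>Expanding the first factor along \<open>a\<close> on the left and along \<open>b\<close>
  on the right gives the same double sum, except that \<open>e a b\<close> becomes
  \<open>e b a\<close>; hence the sign.\<close>

lemma pf_list_exchange:
  assumes skew: "\<And>a b. e a b = - e b a"
  shows "signed_sum (\<lambda>a. pf_list e (a # bs)) (pf_list e) as =
    - signed_sum (\<lambda>b. pf_list e (b # as)) (pf_list e) bs"
proof -
  have "signed_sum (\<lambda>a. pf_list e (a # bs)) (pf_list e) as =
      signed_sum (\<lambda>b. signed_sum (\<lambda>a. e a b) (pf_list e) as) (pf_list e) bs"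
    unfolding pf_list.simps by (rule signed_sum_exchange)
  also have "\<dots> = signed_sum (\<lambda>b. - pf_list e (b # as)) (pf_list e) bs"
  proof (intro signed_sum_cong refl)
    fix b
    have "(\<lambda>a. e a b) = (\<lambda>a. - e b a)"
      by (intro ext skew)
    then show "signed_sum (\<lambda>a. e a b) (pf_list e) as = - pf_list e (b # as)"
      by (simp add: signed_sum_uminus_left)
  qed
  finally show ?thesis
    by (simp add: signed_sum_uminus_left)
qed

lemma signed_sum_pf_list_vanish:
  fixes e :: "'s \<Rightarrow> 's \<Rightarrow> 'a::{idom, ring_char_0}"
  assumes skew: "\<And>a b. e a b = - e b a" and "set as \<subseteq> set bs"
  shows "signed_sum (\<lambda>a. pf_list e (a # bs)) G as = 0"
proof -
  have "signed_sum (\<lambda>a. pf_list e (a # bs)) G as = signed_sum (\<lambda>a. 0) G as"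
    using assms(2) by (intro signed_sum_cong alternating_repeat alternating_pf_list skew) auto
  then show ?thesis
    by (simp add: signed_sum_zero_left)
qed

lemma pf_list_pluecker_4:
  fixes e :: "'s \<Rightarrow> 's \<Rightarrow> 'a::{idom, ring_char_0}"
  assumes skew: "\<And>a b. e a b = - e b a"
  shows "pf_list e (a # M) * pf_list e (b # c # d # M) -
      pf_list e (b # M) * pf_list e (a # c # d # M) +
      pf_list e (c # M) * pf_list e (a # b # d # M) -
      pf_list e (d # M) * pf_list e (a # b # c # M) = 0"
proof -
  \<comment> \<open>On the other side of the exchange, each symbol taken from \<open>M\<close>
    already occurs in \<open>a # b # c # d # M\<close>, so that side vanishes.\<close>
  have "signed_sum (\<lambda>x. pf_list e (x # M)) (pf_list e) (a # b # c # d # M) = 0"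
    using pf_list_exchange[of e M "a # b # c # d # M", OF skew]
      signed_sum_pf_list_vanish[of e M "a # b # c # d # M" "pf_list e", OF skew] by auto
  moreover have "signed_sum (\<lambda>x. pf_list e (x # M)) G M = 0" for G
    by (rule signed_sum_pf_list_vanish[of e, OF skew]) simp
  ultimately show ?thesis
    by (simp del: pf_list.simps)
qed

lemma pf_list_pluecker_0_4:
  fixes e :: "'s \<Rightarrow> 's \<Rightarrow> 'a::{idom, ring_char_0}"
  assumes skew: "\<And>a b. e a b = - e b a"
  shows "pf_list e M * pf_list e (a # b # c # d # M) =
    pf_list e (a # b # M) * pf_list e (c # d # M) -
    pf_list e (a # c # M) * pf_list e (b # d # M) +
    pf_list e (a # d # M) * pf_list e (b # c # M)"
proof -
  have swap: "pf_list e (x # a # M) = - pf_list e (a # x # M)" for x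
    using alternatingD[OF alternating_pf_list[of e, OF skew], of "[]"] by simp
  \<comment> \<open>The exchange is applied to \<open>a # M\<close> and
    \<open>b # c # d # M\<close>; repeated symbols leave one term on the left and three on the
    right.\<close>
  have "signed_sum (\<lambda>x. pf_list e (x # b # c # d # M)) G M = 0" for G
    by (rule signed_sum_pf_list_vanish[of e, OF skew]) auto
  moreover have "signed_sum (\<lambda>x. pf_list e (x # a # M)) G M = 0" for G
    by (rule signed_sum_pf_list_vanish[of e, OF skew]) auto
  moreover note pf_list_exchange[of e "b # c # d # M" "a # M", OF skew]
  ultimately show ?thesis
    by (simp del: pf_list.simps add: swap algebra_simps)
qed

text \<open>The entries change by the wedge of two covectors. Terms of second order would contract
  twice by \<open>u\<close> or by \<open>w\<close>, which gives 0, so the correction stops at first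
  order. The set \<open>S\<close> is there because only entries between indices will follow this
  law; those with \<open>D0\<close> change differently.\<close>

lemma pf_list_rank_two_update:
  fixes e :: "'s \<Rightarrow> 's \<Rightarrow> 'a::{idom, ring_char_0}"
  assumes "\<And>a b. a \<in> S \<Longrightarrow> b \<in> S \<Longrightarrow> e' a b = e a b - u a * w b + u b * w a"
    and "set as \<subseteq> S"
  shows "pf_list e' as = pf_list e as - signed_sum u (signed_sum w (pf_list e)) as"
  using assms(2)
proof (induction "length as" arbitrary: as rule: less_induct)
  case less
  show ?case
  proof (cases as)
    case (Cons a bs)
    let ?P = "pf_list e"
    let ?Q = "\<lambda>l. ?P l - signed_sum u (signed_sum w ?P) l"
    have "pf_list e' as = signed_sum (\<lambda>b. e a b - u a * w b + w a * u b) ?Q bs"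
      using less Cons by (auto intro!: signed_sum_cong simp: assms(1) mult.commute)
    also have "\<dots> = signed_sum (e a) ?P bs - signed_sum (e a) (signed_sum u (signed_sum w ?P)) bs
        - u a * (signed_sum w ?P bs - signed_sum w (signed_sum u (signed_sum w ?P)) bs)
        + w a * (signed_sum u ?P bs - signed_sum u (signed_sum u (signed_sum w ?P)) bs)"
      by (simp only: signed_sum_add_left signed_sum_diff_left signed_sum_mult_left
          signed_sum_diff_right)
    also have "signed_sum u (signed_sum u (signed_sum w ?P)) bs = 0"
      by (rule signed_sum_square)
    also have "signed_sum w (signed_sum u (signed_sum w ?P)) bs = 0"
      by (rule signed_sum_sandwich)
    \<comment> \<open>Moving \<open>e a\<close> inwards past both contractions costs two signs,
      which cancel.\<close>
    also have "signed_sum (e a) (signed_sum u (signed_sum w ?P)) bs =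
        signed_sum u (signed_sum w (signed_sum (e a) ?P)) bs"
    proof -
      have "signed_sum (e a) (signed_sum w ?P) = (\<lambda>l. - signed_sum w (signed_sum (e a) ?P) l)"
        by (rule ext) (rule signed_sum_anticommute)
      then show ?thesis
        unfolding signed_sum_anticommute[of "e a" u "signed_sum w ?P" bs]
        by (simp add: signed_sum_uminus_right)
    qed
    finally show ?thesis
      using Cons by (simp add: signed_sum_diff_right signed_sum_mult_right algebra_simps)
  qed simp
qed

section \<open>Derivatives\<close>

text \<open>
  The weight \<open>c\<close> is 0 on \<open>d\<^sub>0\<close> and \<open>d\<^sub>1\<close>, whose entries are differentiated by shifting
  the other index only, and 1 on the indices.
\<close>

primrec shift_sum :: "('s \<Rightarrow> 'a::comm_ring_1) \<Rightarrow> ('s \<Rightarrow> 's) \<Rightarrow> ('s list \<Rightarrow> 'a) \<Rightarrow> 's list \<Rightarrow> 'a"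
  where
  "shift_sum c \<sigma> G [] = 0"
| "shift_sum c \<sigma> G (a # as) = c a * G (\<sigma> a # as) + shift_sum c \<sigma> (\<lambda>l. G (a # l)) as"

lemma shift_sum_diff:
  "shift_sum c \<sigma> (\<lambda>l. F l - G l) as = shift_sum c \<sigma> F as - shift_sum c \<sigma> G as"
  by (induction as arbitrary: F G) (simp_all add: algebra_simps)

lemma shift_sum_mult: "shift_sum c \<sigma> (\<lambda>l. x * G l) as = x * shift_sum c \<sigma> G as"
  by (induction as arbitrary: G) (simp_all add: algebra_simps)

text \<open>Leibniz rule: the shift acts either on the removed symbol or on one of those that
  remain.\<close>

lemma shift_sum_signed_sum:
  "shift_sum c \<sigma> (signed_sum H G) as =
    signed_sum (\<lambda>b. c b * H (\<sigma> b)) G as + signed_sum H (shift_sum c \<sigma> G) as"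
  by (induction as arbitrary: G)
    (simp_all add: shift_sum_diff shift_sum_mult signed_sum_add_right signed_sum_mult_right,
     simp add: algebra_simps)

lemma has_real_derivative_signed_sum:
  assumes "\<And>a. a \<in> set as \<Longrightarrow> ((\<lambda>s. H s a) has_real_derivative H' a) (at t)"
    and "\<And>l. length l < length as \<Longrightarrow> set l \<subseteq> set as \<Longrightarrow>
      ((\<lambda>s. G s l) has_real_derivative G' l) (at t)"
  shows "((\<lambda>s. signed_sum (H s) (G s) as) has_real_derivative
    signed_sum H' (G t) as + signed_sum (H t) G' as) (at t)"
  using assms
proof (induction as arbitrary: G G')
  case (Cons a as)
  have "((\<lambda>s. G s (a # l)) has_real_derivative G' (a # l)) (at t)"
    if "length l < length as" "set l \<subseteq> set as" for l
    using that by (intro Cons.prems(2)) auto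
  then have "((\<lambda>s. signed_sum (H s) (\<lambda>l. G s (a # l)) as) has_real_derivative
      signed_sum H' (\<lambda>l. G t (a # l)) as + signed_sum (H t) (\<lambda>l. G' (a # l)) as) (at t)"
    using Cons.prems(1) by (intro Cons.IH) auto
  moreover have "((\<lambda>s. H s a) has_real_derivative H' a) (at t)"
    "((\<lambda>s. G s as) has_real_derivative G' as) (at t)"
    using Cons.prems by auto
  ultimately show ?case
    by (auto intro!: derivative_eq_intros)
qed simp

lemma has_real_derivative_pf_list:
  assumes "\<And>a b. ((\<lambda>s. e s a b) has_real_derivative
      c a * e t (\<sigma> a) b + c b * e t a (\<sigma> b)) (at t)"
  shows "((\<lambda>s. pf_list (e s) as) has_real_derivative shift_sum c \<sigma> (pf_list (e t)) as) (at t)"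
proof (induction "length as" arbitrary: as rule: less_induct)
  case less
  show ?case
  proof (cases as)
    case (Cons a bs)
    have "((\<lambda>s. signed_sum (e s a) (pf_list (e s)) bs) has_real_derivative
        signed_sum (\<lambda>b. c a * e t (\<sigma> a) b + c b * e t a (\<sigma> b)) (pf_list (e t)) bs +
        signed_sum (e t a) (shift_sum c \<sigma> (pf_list (e t))) bs) (at t)"
      using less Cons assms by (intro has_real_derivative_signed_sum) auto
    then show ?thesis
      using Cons by (simp add: shift_sum_signed_sum signed_sum_add_left signed_sum_mult_left add.assoc)
  qed simp
qed

text \<open>Raising any index but the last repeats its successor, so alternation kills the term. The
  induction runs down from \<open>j\<close>, and \<open>G\<close> varies in order to absorb the
  prefix.\<close>

lemma shift_sum_consecutive:
  fixes G :: "symb list \<Rightarrow> 'a::{idom, ring_char_0}"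
  assumes "alternating G" and "i \<le> j" and c: "\<And>i. c (Ix i) = 1" and \<sigma>: "\<And>i. \<sigma> (Ix i) = Ix (Suc i)"
  shows "shift_sum c \<sigma> G (map Ix [i..<Suc j]) = G (map Ix [i..<j] @ [Ix (Suc j)])"
  using assms(2,1)
proof (induction i arbitrary: G rule: inc_induct)
  case base
  then show ?case by (simp add: c \<sigma>)
next
  case (step i)
  have "[i..<Suc j] = i # [Suc i..<Suc j]" "[i..<j] = i # [Suc i..<j]"
    using step.hyps by (simp_all add: upt_conv_Cons)
  moreover have "G (Ix (Suc i) # map Ix [Suc i..<Suc j]) = 0"
    using step.hyps by (intro alternating_repeat step.prems) auto
  ultimately show ?case
    using step.IH[OF alternating_Cons[OF step.prems, of "Ix i"]]
    by (simp del: upt_Suc add: c \<sigma>)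
qed

section \<open>Level shift and the bilinear relation\<close>

lemma pf_list_append_one:
  assumes skew: "\<And>a b. e a b = - e b a"
  shows "pf_list e (xs @ M @ [a]) = (- 1) ^ length M * pf_list e (xs @ a # M)"
  using alternating_move_back[OF alternating_pf_list[of e, OF skew], of xs M a "[]"]
  by (simp only: append_Nil2)

lemma pf_list_append_two:
  assumes skew: "\<And>a b. e a b = - e b a"
  shows "pf_list e (xs @ M @ [a, b]) = pf_list e (xs @ a # b # M)"
proof -
  have "pf_list e (xs @ M @ [a, b]) = (- 1) ^ length M * pf_list e (xs @ a # M @ [b])"
    by (rule alternating_move_back) (rule alternating_pf_list[of e, OF skew])
  also have "pf_list e (xs @ a # M @ [b]) = (- 1) ^ length M * pf_list e (xs @ a # b # M)"
    using pf_list_append_one[of e "xs @ [a]" M b, OF skew] by simp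
  finally show ?thesis
    by (simp add: mult.assoc[symmetric])
qed

text \<open>Since \<open>e D0 D1 = 0\<close>, expanding along \<open>D0\<close> and then
  \<open>D1\<close> identifies the rank-two correction with the Pfaffian that has \<open>D0\<close>,
  \<open>D1\<close> in front. With a leading \<open>D0\<close>, the correction is contracted once
  more by \<open>e D0\<close> or \<open>e D1\<close>, hence twice by the same covector, and
  disappears.\<close>

lemma pf_list_level_shift:
  fixes e e' :: "symb \<Rightarrow> symb \<Rightarrow> 'a::{idom, ring_char_0}"
  assumes D: "e D0 D1 = 0"
    and Ix: "\<And>i j. e' (Ix i) (Ix j) =
      e (Ix i) (Ix j) - e D0 (Ix i) * e D1 (Ix j) + e D0 (Ix j) * e D1 (Ix i)"
    and D0: "\<And>i. e' D0 (Ix i) = e D0 (Ix i) + e D1 (Ix i)"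
  shows "pf_list e' (map Ix ns) = pf_list e (map Ix ns) + pf_list e (D0 # D1 # map Ix ns)"
    and "pf_list e' (D0 # map Ix ns) = pf_list e (D0 # map Ix ns) + pf_list e (D1 # map Ix ns)"
proof -
  let ?u = "e D0" and ?w = "e D1" and ?P = "pf_list e"
  have update: "pf_list e' l = ?P l - signed_sum ?u (signed_sum ?w ?P) l"
    if "set l \<subseteq> range Ix" for l
    using that by (intro pf_list_rank_two_update[of "range Ix"]) (auto simp: Ix)
  from update[of "map Ix ns"] D
  show "pf_list e' (map Ix ns) = ?P (map Ix ns) + ?P (D0 # D1 # map Ix ns)"
    by auto
  have "pf_list e' (D0 # map Ix ns) =
      signed_sum (\<lambda>b. ?u b + ?w b) (\<lambda>l. ?P l - signed_sum ?u (signed_sum ?w ?P) l) (map Ix ns)"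
    unfolding pf_list.simps
  proof (rule signed_sum_cong)
    fix l assume "set l \<subseteq> set (map Ix ns)"
    then show "pf_list e' l = ?P l - signed_sum ?u (signed_sum ?w ?P) l"
      by (intro update) auto
  qed (auto simp: D0)
  then show "pf_list e' (D0 # map Ix ns) = ?P (D0 # map Ix ns) + ?P (D1 # map Ix ns)"
    by (simp add: signed_sum_add_left signed_sum_diff_right signed_sum_square signed_sum_sandwich)
qed

text \<open>Once the level shift is inserted, products without \<open>D1\<close> cancel, and what
  remains is a Pluecker relation in \<open>D0\<close>, \<open>D1\<close>, \<open>a\<close>,
  \<open>b\<close> over \<open>M\<close>. The parity of \<open>M\<close> selects the relation and
  the sign of moving one symbol past \<open>M\<close>.\<close>

lemma pf_list_bilinear:
  fixes e e' :: "symb \<Rightarrow> symb \<Rightarrow> 'a::{idom, ring_char_0}"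
    and ns :: "nat list" and i j :: nat
  assumes skew: "\<And>a b. e a b = - e b a"
    and D: "e D0 D1 = 0"
    and Ix: "\<And>i j. e' (Ix i) (Ix j) =
      e (Ix i) (Ix j) - e D0 (Ix i) * e D1 (Ix j) + e D0 (Ix j) * e D1 (Ix i)"
    and D0: "\<And>i. e' D0 (Ix i) = e D0 (Ix i) + e D1 (Ix i)"
  defines "M \<equiv> map Ix ns" and "a \<equiv> Ix i" and "b \<equiv> Ix j"
  shows "even (length ns) \<Longrightarrow>
      pf_list e' (D0 # M @ [b]) * pf_list e (D0 # M @ [a]) -
      pf_list e' (D0 # M @ [a]) * pf_list e (D0 # M @ [b]) =
      pf_list e (M @ [a, b]) * pf_list e' M - pf_list e' (M @ [a, b]) * pf_list e M"
    and "odd (length ns) \<Longrightarrow>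
      pf_list e' (M @ [b]) * pf_list e (M @ [a]) - pf_list e' (M @ [a]) * pf_list e (M @ [b]) =
      pf_list e (D0 # M @ [a, b]) * pf_list e' (D0 # M) -
      pf_list e' (D0 # M @ [a, b]) * pf_list e (D0 # M)"
proof -
  note level = pf_list_level_shift[of e e', OF D Ix D0]
  have level_M: "pf_list e' M = pf_list e M + pf_list e (D0 # D1 # M)"
    "pf_list e' (D0 # M) = pf_list e (D0 # M) + pf_list e (D1 # M)"
    unfolding M_def by (rule level)+
  have level_1: "pf_list e' (M @ [Ix n]) = pf_list e (M @ [Ix n]) + pf_list e (D0 # D1 # M @ [Ix n])"
    "pf_list e' (D0 # M @ [Ix n]) = pf_list e (D0 # M @ [Ix n]) + pf_list e (D1 # M @ [Ix n])" for n
    using level[of "ns @ [n]"] by (simp_all only: M_def map_append list.map)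
  have level_2: "pf_list e' (M @ [a, b]) = pf_list e (M @ [a, b]) + pf_list e (D0 # D1 # M @ [a, b])"
    "pf_list e' (D0 # M @ [a, b]) = pf_list e (D0 # M @ [a, b]) + pf_list e (D1 # M @ [a, b])"
    using level[of "ns @ [i, j]"] by (simp_all only: M_def a_def b_def map_append list.map)
  have one: "pf_list e (M @ [x]) = (- 1) ^ length ns * pf_list e (x # M)"
    "pf_list e (y # M @ [x]) = (- 1) ^ length ns * pf_list e (y # x # M)"
    "pf_list e (y # z # M @ [x]) = (- 1) ^ length ns * pf_list e (y # z # x # M)" for x y z
    using pf_list_append_one[of e "[]" M x, OF skew] pf_list_append_one[of e "[y]" M x, OF skew]
      pf_list_append_one[of e "[y, z]" M x, OF skew]
    by (simp_all only: M_def length_map append.simps)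
  have two: "pf_list e (M @ [a, b]) = pf_list e (a # b # M)"
    "pf_list e (y # M @ [a, b]) = pf_list e (y # a # b # M)"
    "pf_list e (y # z # M @ [a, b]) = pf_list e (y # z # a # b # M)" for y z
    using pf_list_append_two[of e "[]" M a b, OF skew] pf_list_append_two[of e "[y]" M a b, OF skew]
      pf_list_append_two[of e "[y, z]" M a b, OF skew]
    by (simp_all only: append.simps)
  note expand = level_M level_1[of i, folded a_def] level_1[of j, folded b_def] level_2 one two
  show "pf_list e' (D0 # M @ [b]) * pf_list e (D0 # M @ [a]) -
      pf_list e' (D0 # M @ [a]) * pf_list e (D0 # M @ [b]) =
      pf_list e (M @ [a, b]) * pf_list e' M - pf_list e' (M @ [a, b]) * pf_list e M"
    if "even (length ns)"
  proof -
    have sign: "(- 1 :: 'a) ^ length ns = 1"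
      using that by simp
    show ?thesis
      unfolding expand sign mult_1_left
      using pf_list_pluecker_0_4[of e M D0 D1 a b, OF skew] by algebra
  qed
  show "pf_list e' (M @ [b]) * pf_list e (M @ [a]) - pf_list e' (M @ [a]) * pf_list e (M @ [b]) =
      pf_list e (D0 # M @ [a, b]) * pf_list e' (D0 # M) -
      pf_list e' (D0 # M @ [a, b]) * pf_list e (D0 # M)"
    if "odd (length ns)"
  proof -
    have sign: "(- 1 :: 'a) ^ length ns = - 1"
      using that by simp
    show ?thesis
      unfolding expand sign
      using pf_list_pluecker_4[of e D0 M D1 a b, OF skew] by algebra
  qed
qed

section \<open>The tau functions\<close>

text \<open>One list for both parities of the subscript, always of even length.\<close>

definition tau_symbols :: "nat \<Rightarrow> symb list" where
  "tau_symbols n = (if even n then [] else [D0]) @ map Ix [0..<n]"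

lemma bkp_tau_eq_pf_list:
  assumes skew: "\<And>a b. pf_entry \<mu> \<beta> k t a b = - pf_entry \<mu> \<beta> k t b a"
  shows "bkp_tau \<mu> \<beta> n k t = pf_list (pf_entry \<mu> \<beta> k t) (tau_symbols n)"
  unfolding bkp_tau_def bkp_pf_def tau_symbols_def
  using hirota_pf_eq_pf_list[of "pf_entry \<mu> \<beta> k t" "map Ix [0..<n]", OF skew]
    hirota_pf_eq_pf_list[of "pf_entry \<mu> \<beta> k t" "D0 # map Ix [0..<n]", OF skew]
  by (simp del: pf_list.simps)

text \<open>The subscript \<open>Suc m\<close> means that the last index is \<open>m\<close>, which
  the shift raises to \<open>Suc m\<close>; \<open>D0\<close> is present for even \<open>m\<close>,
  when the subscript is odd.\<close>

lemma has_real_derivative_pf_list_tau_symbols: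
  assumes skew: "\<And>a b. pf_entry \<mu> \<beta> k t a b = - pf_entry \<mu> \<beta> k t b a"
    and \<mu>: "\<And>i j. ((\<lambda>s. \<mu> i j k s) has_real_derivative \<mu> (i + 1) j k t + \<mu> i (j + 1) k t) (at t)"
    and \<beta>: "\<And>i. ((\<lambda>s. \<beta> i k s) has_real_derivative \<beta> (i + 1) k t) (at t)"
  shows "((\<lambda>s. pf_list (pf_entry \<mu> \<beta> k s) (tau_symbols (Suc m))) has_real_derivative
    pf_list (pf_entry \<mu> \<beta> k t) ((if even m then [D0] else []) @ map Ix [0..<m] @ [Ix (Suc m)])) (at t)"
proof -
  define c :: "symb \<Rightarrow> real" where "c = (\<lambda>a. case a of Ix i \<Rightarrow> 1 | _ \<Rightarrow> 0)"
  define \<sigma> where "\<sigma> = (\<lambda>a. case a of Ix i \<Rightarrow> Ix (Suc i) | _ \<Rightarrow> a)"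
  let ?P = "pf_list (pf_entry \<mu> \<beta> k t)"
  have "((\<lambda>s. pf_entry \<mu> \<beta> k s a b) has_real_derivative
      c a * pf_entry \<mu> \<beta> k t (\<sigma> a) b + c b * pf_entry \<mu> \<beta> k t a (\<sigma> b)) (at t)" for a b
    using \<mu> \<beta> by (cases a; cases b) (auto simp: c_def \<sigma>_def intro!: DERIV_minus)
  then have "((\<lambda>s. pf_list (pf_entry \<mu> \<beta> k s) (tau_symbols (Suc m))) has_real_derivative
      shift_sum c \<sigma> ?P (tau_symbols (Suc m))) (at t)"
    by (rule has_real_derivative_pf_list)
  moreover have alt: "alternating ?P"
    by (rule alternating_pf_list) (rule skew)
  have "shift_sum c \<sigma> G (map Ix [0..<Suc m]) = G (map Ix [0..<m] @ [Ix (Suc m)])"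
    if "alternating G" for G
    using that by (intro shift_sum_consecutive) (simp_all add: c_def \<sigma>_def)
  from this[OF alt] this[OF alternating_Cons[OF alt, of D0]]
  have "shift_sum c \<sigma> ?P (tau_symbols (Suc m)) =
      ?P ((if even m then [D0] else []) @ map Ix [0..<m] @ [Ix (Suc m)])"
    by (simp add: tau_symbols_def c_def del: pf_list.simps upt_Suc)
  ultimately show ?thesis by simp
qed

text \<open>The case \<open>a = Ix m\<close>, \<open>b = Ix (Suc m)\<close>: after the first
  \<open>m\<close> indices, appending \<open>a\<close> gives the tau function itself, appending
  \<open>b\<close> its derivative, and appending both the next tau function.\<close>

lemma pf_list_tau_symbols_bilinear:
  fixes e e' :: "symb \<Rightarrow> symb \<Rightarrow> 'a::{idom, ring_char_0}"
    and m :: nat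
  assumes skew: "\<And>a b. e a b = - e b a"
    and D: "e D0 D1 = 0"
    and Ix: "\<And>i j. e' (Ix i) (Ix j) =
      e (Ix i) (Ix j) - e D0 (Ix i) * e D1 (Ix j) + e D0 (Ix j) * e D1 (Ix i)"
    and D0: "\<And>i. e' D0 (Ix i) = e D0 (Ix i) + e D1 (Ix i)"
  defines "l \<equiv> (if even m then [D0] else []) @ map Ix [0..<m] @ [Ix (Suc m)]"
  shows "pf_list e' l * pf_list e (tau_symbols (Suc m)) - pf_list e' (tau_symbols (Suc m)) * pf_list e l =
    pf_list e (tau_symbols (Suc (Suc m))) * pf_list e' (tau_symbols m) -
    pf_list e' (tau_symbols (Suc (Suc m))) * pf_list e (tau_symbols m)"
  using pf_list_bilinear[of e e' "[0..<m]" "Suc m" m, OF skew D Ix D0]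
  unfolding l_def tau_symbols_def by (cases "even m") (simp_all del: pf_list.simps)

section \<open>The lattice equations from the bilinear relation\<close>

lemma pf_entry_skew:
  assumes "\<And>i j. \<mu> i j k t = - \<mu> j i k t"
  shows "pf_entry \<mu> \<beta> k t a b = - pf_entry \<mu> \<beta> k t b a"
  by (cases a; cases b) (simp_all, rule assms)

theorem theorem3p29:
  fixes I :: "real set"
    and \<mu> :: "nat \<Rightarrow> nat \<Rightarrow> nat \<Rightarrow> real \<Rightarrow> real"
    and \<beta> :: "nat \<Rightarrow> nat \<Rightarrow> real \<Rightarrow> real"
  assumes "open I" and "is_interval I"
    and "\<And>i j k. smooth_real_on I (\<mu> i j k)"
    and "\<And>i k. smooth_real_on I (\<beta> i k)"
    and "\<And>i j k t. t \<in> I \<Longrightarrow> \<mu> i j k t = - \<mu> j i k t"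
    and "\<And>i j k t. t \<in> I \<Longrightarrow>
      ((\<lambda>s. pf_entry \<mu> \<beta> k s (Ix i) (Ix j)) has_real_derivative
        pf_entry \<mu> \<beta> k t (Ix (i + 1)) (Ix j) + pf_entry \<mu> \<beta> k t (Ix i) (Ix (j + 1))) (at t)"
    and "\<And>i k t. t \<in> I \<Longrightarrow>
      ((\<lambda>s. pf_entry \<mu> \<beta> k s D0 (Ix i)) has_real_derivative
        pf_entry \<mu> \<beta> k t D0 (Ix (i + 1))) (at t)"
    and "\<And>i j k t. t \<in> I \<Longrightarrow>
      pf_entry \<mu> \<beta> (k + 1) t (Ix i) (Ix j) =
        pf_entry \<mu> \<beta> k t (Ix i) (Ix j) + bkp_pf \<mu> \<beta> k t [D0, D1, Ix i, Ix j]"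
    and "\<And>i k t. t \<in> I \<Longrightarrow>
      pf_entry \<mu> \<beta> (k + 1) t D0 (Ix i) =
        pf_entry \<mu> \<beta> k t D0 (Ix i) + pf_entry \<mu> \<beta> k t D1 (Ix i)"
    and "\<And>n k t. t \<in> I \<Longrightarrow> bkp_tau \<mu> \<beta> n k t \<noteq> 0"
  shows "(\<forall>n\<ge>1. \<forall>k. \<forall>t\<in>I.
      ((\<lambda>s. bkp_r \<mu> \<beta> n k s) has_real_derivative
        (bkp_v \<mu> \<beta> n k t * bkp_r \<mu> \<beta> n k t) /
          (bkp_v \<mu> \<beta> (n - 1) k t * bkp_r \<mu> \<beta> (n - 1) k t) *
          (bkp_r \<mu> \<beta> (n - 1) k t - bkp_r \<mu> \<beta> (n + 1) k t)) (at t))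
    \<and> (\<forall>n. \<forall>k\<ge>1. \<forall>t\<in>I.
      bkp_v \<mu> \<beta> n k t * bkp_r \<mu> \<beta> n k t =
        bkp_r \<mu> \<beta> (n + 1) (k - 1) t * bkp_v \<mu> \<beta> n (k - 1) t)"
proof (intro conjI allI ballI impI)
  have skew: "pf_entry \<mu> \<beta> k t a b = - pf_entry \<mu> \<beta> k t b a" if "t \<in> I" for k t a b
    by (rule pf_entry_skew) (rule assms(5)[OF that])
  have tau: "bkp_tau \<mu> \<beta> n k t = pf_list (pf_entry \<mu> \<beta> k t) (tau_symbols n)" if "t \<in> I" for n k t
    by (rule bkp_tau_eq_pf_list) (rule skew[OF that])
  {
    fix n k :: nat and t :: real
    assume "1 \<le> n" and t: "t \<in> I"
    then obtain m where n: "n = Suc m"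
      by (cases n) auto
    let ?T = "\<lambda>n k. bkp_tau \<mu> \<beta> n k t"
    let ?l = "(if even m then [D0] else []) @ map Ix [0..<m] @ [Ix (Suc m)]"
    let ?T' = "\<lambda>k. pf_list (pf_entry \<mu> \<beta> k t) ?l"
    \<comment> \<open>The entries are known to be skew only on \<open>I\<close>, so the two
      expressions for the tau function agree only there; openness of \<open>I\<close> lets the
      derivative be transferred.\<close>
    have deriv: "((\<lambda>s. bkp_tau \<mu> \<beta> n k s) has_real_derivative ?T' k) (at t)" for k
    proof (rule has_field_derivative_transform_within_open[OF _ \<open>open I\<close> t])
      show "((\<lambda>s. pf_list (pf_entry \<mu> \<beta> k s) (tau_symbols n)) has_real_derivative ?T' k) (at t)"
        unfolding n using assms(6)[OF t, of k] assms(7)[OF t, of k]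
        by (intro has_real_derivative_pf_list_tau_symbols skew[OF t]) simp_all
    qed (rule tau[symmetric])
    \<comment> \<open>This puts the assumed change of level into the form of a rank-two update by
      the covectors \<open>e D0\<close> and \<open>e D1\<close>.\<close>
    have four: "bkp_pf \<mu> \<beta> k t [D0, D1, Ix i, Ix j] =
        - \<beta> i k t * \<beta> (j + 1) k t + \<beta> j k t * \<beta> (i + 1) k t" for i j
      unfolding bkp_pf_def
      by (subst hirota_pf_eq_pf_list[OF skew[OF t]]) simp_all
    have bilinear: "?T' (k + 1) * ?T n k - ?T n (k + 1) * ?T' k =
        ?T (n + 1) k * ?T (n - 1) (k + 1) - ?T (n + 1) (k + 1) * ?T (n - 1) k"
      unfolding tau[OF t] n add_Suc_right add_0_right One_nat_def diff_Suc_Suc diff_zero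
      by (rule pf_list_tau_symbols_bilinear[OF skew[OF t]])
        (use assms(8)[OF t, of k] assms(9)[OF t, of k] in \<open>simp_all add: four\<close>)
    have "((\<lambda>s. bkp_r \<mu> \<beta> n k s) has_real_derivative
        (?T' (k + 1) * ?T n k - ?T n (k + 1) * ?T' k) / (?T n k * ?T n k)) (at t)"
      unfolding bkp_r_def using deriv assms(10)[OF t] by (intro DERIV_divide)
    \<comment> \<open>Here \<open>v * r\<close> at \<open>n\<close> collapses to the quotient of the
      tau functions with subscripts \<open>n + 1\<close> and \<open>n\<close> at level
      \<open>k\<close>; the prefactor is then their second-order ratio around
      \<open>n\<close>.\<close>
    also have "(?T' (k + 1) * ?T n k - ?T n (k + 1) * ?T' k) / (?T n k * ?T n k) =
        (bkp_v \<mu> \<beta> n k t * bkp_r \<mu> \<beta> n k t) /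
          (bkp_v \<mu> \<beta> (n - 1) k t * bkp_r \<mu> \<beta> (n - 1) k t) *
          (bkp_r \<mu> \<beta> (n - 1) k t - bkp_r \<mu> \<beta> (n + 1) k t)"
      unfolding bilinear unfolding bkp_r_def bkp_v_def n
      using assms(10)[OF t] by (simp add: field_simps)
    finally show "((\<lambda>s. bkp_r \<mu> \<beta> n k s) has_real_derivative
        (bkp_v \<mu> \<beta> n k t * bkp_r \<mu> \<beta> n k t) /
          (bkp_v \<mu> \<beta> (n - 1) k t * bkp_r \<mu> \<beta> (n - 1) k t) *
          (bkp_r \<mu> \<beta> (n - 1) k t - bkp_r \<mu> \<beta> (n + 1) k t)) (at t)" .
  }
  fix n k :: nat and t :: real
  assume "1 \<le> k" and t: "t \<in> I"
  \<comment> \<open>Both sides reduce to the quotient of the tau functions with subscripts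
    \<open>n + 1\<close> and \<open>n\<close> at level \<open>k\<close>.\<close>
  then show "bkp_v \<mu> \<beta> n k t * bkp_r \<mu> \<beta> n k t =
      bkp_r \<mu> \<beta> (n + 1) (k - 1) t * bkp_v \<mu> \<beta> n (k - 1) t"
    using assms(10)[OF t] by (simp add: bkp_r_def bkp_v_def)
qed

end
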